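(* Let $X$ be a real Hilbert space, let $m\in\{2,3,\dots\}$, let $A_1,\dots,A_m: X\rightrightarrows X$ be maximally monotone operators, and let $\mathbf Z=\operatorname{Fix}(\mathbf J_{\mathbf A}\mathbf R)$. Then $$\mathbf Z=\operatorname{Fix}(\mathbf J_{\mathbf A}\mathbf R)=\operatorname{Fix}\left(\mathbf J_{\frac12\mathbf A}\circ\frac{\mathbf{Id}+\mathbf R}{2}\right).$$
   Context: $\mathbf X=X^m$ is the Hilbert product space and $\mathbf{Id}$ its identity. $\mathbf A=A_1\times\cdots\times A_m:\mathbf X\rightrightarrows\mathbf X$. For a maximally monotone operator $\mathbf B$ on $\mathbf X$, $\mathbf J_{\mathbf B}=(\mathbf{Id}+\mathbf B)^{-1}$ is its resolvent. $\mathbf R:\mathbf X\to\mathbf X:(x_1,\dots,x_m)\mapsto(x_m,x_1,\dots,x_{m-1})$ is the circular right-shift operator. $\operatorname{Fix}S=\{x\mid x=Sx\}$. *)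

theory Defs
  imports "HOL-Analysis.Analysis"
begin

text \<open>A set-valued operator on \<open>X\<close> is a function \<open>X \<Rightarrow> X set\<close>. As usual, an operator is identified
  with a point-valued map wherever its values are singletons.\<close>

definition monotone_op :: "('a::real_inner \<Rightarrow> 'a set) \<Rightarrow> bool" where
  "monotone_op B \<longleftrightarrow> (\<forall>x y. \<forall>u\<in>B x. \<forall>v\<in>B y. 0 \<le> (x - y) \<bullet> (u - v))"

definition maximally_monotone :: "('a::real_inner \<Rightarrow> 'a set) \<Rightarrow> bool" where
  "maximally_monotone B \<longleftrightarrow>
     monotone_op B \<and> (\<forall>C. monotone_op C \<and> (\<forall>x. B x \<subseteq> C x) \<longrightarrow> C = B)"

definition inverse_op :: "('a \<Rightarrow> 'b set) \<Rightarrow> 'b \<Rightarrow> 'a set" where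
  "inverse_op T y = {x. y \<in> T x}"

definition scale_op :: "real \<Rightarrow> ('a::real_vector \<Rightarrow> 'a set) \<Rightarrow> 'a \<Rightarrow> 'a set" where
  "scale_op c B x = (\<lambda>u. c *\<^sub>R u) ` B x"

text \<open>The resolvent \<open>(Id + B)\<^sup>-\<^sup>1\<close>, as the inverse of the set-valued operator \<open>Id + B\<close>.\<close>

definition resolvent :: "('a::real_vector \<Rightarrow> 'a set) \<Rightarrow> 'a \<Rightarrow> 'a set" where
  "resolvent B = inverse_op (\<lambda>x. (\<lambda>u. x + u) ` B x)"

text \<open>The condition \<open>x = S x\<close> for an operator identified with a map on the points where its values
  are singletons; a point \<open>x\<close> that is merely one of several elements of \<open>S x\<close> does not count.\<close>

definition Fix :: "('a \<Rightarrow> 'a set) \<Rightarrow> 'a set" where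
  "Fix S = {x. S x = {x}}"

lemma resolvent_at_most_single_valued:
  assumes "monotone_op B" "x \<in> resolvent B z" "y \<in> resolvent B z"
  shows "x = y"
proof -
  obtain u v where u: "u \<in> B x" "z = x + u" and v: "v \<in> B y" "z = y + v"
    using assms(2,3) by (auto simp: resolvent_def inverse_op_def)
  have "0 \<le> (x - y) \<bullet> (u - v)"
    using assms(1) u(1) v(1) by (auto simp: monotone_op_def)
  moreover have "u - v = - (x - y)"
    using u(2) v(2) by (simp add: algebra_simps)
  ultimately have "(x - y) \<bullet> (x - y) \<le> 0"
    by (metis inner_minus_right neg_0_le_iff_le)
  then show ?thesis
    by (metis eq_iff_diff_eq_0 inner_eq_zero_iff inner_ge_zero order_antisym)
qed

text \<open>The Hilbert product space \<open>X\<^sup>m\<close> is the type \<open>'a ^ 'm\<close>, whose inner product is the sum of the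
  componentwise ones. A bijection \<open>e\<close> from \<open>{1..m}\<close> onto the index type numbers the coordinates:
  the tuple \<open>(x\<^sub>1, \<dots>, x\<^sub>m)\<close> is the vector \<open>x\<close> with \<open>x\<^sub>i = x $ e i\<close>.\<close>

definition product_op ::
  "nat \<Rightarrow> (nat \<Rightarrow> 'm::finite) \<Rightarrow> (nat \<Rightarrow> 'a \<Rightarrow> 'a set) \<Rightarrow> 'a ^ 'm \<Rightarrow> ('a ^ 'm) set" where
  "product_op m e A x = {u. \<forall>i\<in>{1..m}. u $ e i \<in> A i (x $ e i)}"

definition right_shift :: "nat \<Rightarrow> (nat \<Rightarrow> 'm::finite) \<Rightarrow> 'a ^ 'm \<Rightarrow> 'a ^ 'm" where
  "right_shift m e x =
     (\<chi> k. let i = inv_into {1..m} e k in if i = 1 then x $ e m else x $ e (i - 1))"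

end

theory Submission imports Defs begin

text \<open>A point \<open>x\<close> lies in \<open>J\<^sub>B y\<close> exactly when \<open>y - x \<in> B x\<close>. Since a monotone operator has an at
  most single-valued resolvent, the fixed points of \<open>J\<^sub>B \<circ> S\<close> are therefore the solutions of the
  inclusion \<open>S x - x \<in> B x\<close>. Halving both sides of that inclusion turns the displacement
  \<open>S x - x\<close> into the displacement \<open>(x + S x) / 2 - x\<close> of the averaged map and \<open>B\<close> into \<open>B / 2\<close>,
  so the two fixed point problems have the same solutions, for every map \<open>S\<close>. The theorem is the
  case where \<open>B\<close> is the product operator, which inherits monotonicity from its factors because
  the inner product of the product space is the sum of the coordinatewise ones, and where \<open>S\<close>
  is the circular shift.\<close>

lemma mem_resolvent_iff: "x \<in> resolvent B y \<longleftrightarrow> y - x \<in> B x"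
proof -
  have "y = x + u \<longleftrightarrow> u = y - x" for u
    by (auto simp: algebra_simps)
  then show ?thesis
    by (simp add: resolvent_def inverse_op_def image_iff)
qed

lemma Fix_resolvent_comp:
  assumes "monotone_op B"
  shows "Fix (resolvent B \<circ> S) = {x. S x - x \<in> B x}"
proof -
  have "resolvent B (S x) = {x} \<longleftrightarrow> x \<in> resolvent B (S x)" for x
    using resolvent_at_most_single_valued[OF assms] by blast
  then show ?thesis
    by (simp add: Fix_def mem_resolvent_iff)
qed

lemma mem_scale_op_iff:
  assumes "c \<noteq> 0"
  shows "c *\<^sub>R u \<in> scale_op c B x \<longleftrightarrow> u \<in> B x"
  using assms by (auto simp: scale_op_def)

lemma monotone_scale_op:
  assumes "monotone_op B" "c \<ge> 0"
  shows "monotone_op (scale_op c B)"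
  using assms
  by (auto simp: monotone_op_def scale_op_def simp flip: scaleR_diff_right)

lemma Fix_resolvent_average:
  assumes "monotone_op B"
  shows "Fix (resolvent (scale_op (1/2) B) \<circ> (\<lambda>x. (1/2) *\<^sub>R (x + S x))) =
    Fix (resolvent B \<circ> S)"
proof -
  have displacement: "(1/2) *\<^sub>R (x + S x) - x = (1/2) *\<^sub>R (S x - x)" for x
  proof -
    have "(1/2) *\<^sub>R (x + S x) - x = (1/2) *\<^sub>R (x + S x) - (1/2) *\<^sub>R (x + x)"
      by (simp only: scaleR_half_double)
    also have "\<dots> = (1/2) *\<^sub>R ((x + S x) - (x + x))"
      by (simp only: scaleR_diff_right)
    finally show ?thesis
      by simp
  qed
  have "monotone_op (scale_op (1/2) B)"
    by (rule monotone_scale_op[OF assms]) simp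
  then show ?thesis
    using assms by (simp add: Fix_resolvent_comp displacement mem_scale_op_iff)
qed

text \<open>Every coordinate is numbered by \<open>e\<close>, so the inner product in \<open>'a ^ 'm\<close> is a sum of terms that
  the monotonicity of the factors makes nonnegative.\<close>

lemma monotone_product_op:
  fixes A :: "nat \<Rightarrow> 'a::real_inner \<Rightarrow> 'a set" and e :: "nat \<Rightarrow> 'm::finite"
  assumes "e ` {1..m} = UNIV" and "\<And>i. i \<in> {1..m} \<Longrightarrow> monotone_op (A i)"
  shows "monotone_op (product_op m e A)"
  unfolding monotone_op_def
proof (intro allI ballI)
  fix x y u v :: "'a ^ 'm"
  assume u: "u \<in> product_op m e A x" and v: "v \<in> product_op m e A y"
  have "0 \<le> (x $ k - y $ k) \<bullet> (u $ k - v $ k)" for k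
  proof -
    obtain i where "i \<in> {1..m}" "k = e i"
      using assms(1) by blast
    then show ?thesis
      using u v assms(2)[of i] by (auto simp: product_op_def monotone_op_def)
  qed
  then show "0 \<le> (x - y) \<bullet> (u - v)"
    by (simp add: inner_vec_def sum_nonneg)
qed

theorem lemma4p6:
  fixes A :: "nat \<Rightarrow> 'a::{real_inner, complete_space} \<Rightarrow> 'a set"
    and m :: nat
    and e :: "nat \<Rightarrow> 'm::finite"
    and Z :: "('a ^ 'm) set"
  assumes "m \<ge> 2"
    and "bij_betw e {1..m} (UNIV :: 'm set)"
    and "\<And>i. i \<in> {1..m} \<Longrightarrow> maximally_monotone (A i)"
    and "Z = Fix (resolvent (product_op m e A) \<circ> right_shift m e)"
  shows "Z = Fix (resolvent (product_op m e A) \<circ> right_shift m e) \<and>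
    Fix (resolvent (product_op m e A) \<circ> right_shift m e) =
    Fix (resolvent (scale_op (1/2) (product_op m e A)) \<circ>
          (\<lambda>x. (1/2) *\<^sub>R (x + right_shift m e x)))"
proof -
  have "monotone_op (product_op m e A)"
    using assms(2,3)
    by (intro monotone_product_op) (auto simp: bij_betw_def maximally_monotone_def)
  then show ?thesis
    using assms(4) by (simp only: Fix_resolvent_average)
qed

end
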